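(* Let $G$ be an ordered group. If the order is a semiorder, but not an antichain, and $G=I(G)(0)$, then the following propositions are true: (1) Every maximal chain of $G$ is isomorphic to the chain of integers. (2) $K(G)=\{0\}$ and $G$ has no infinite antichain if and only if $G$ is isomorphic to the group of integers equipped with a threshold order.
   Context: Groups are written additively but are not assumed abelian. An ordered group $G=(X,+,\leq)$ is a group with a partial order preserved by all left and right translations; isomorphism in (2) is isomorphism of ordered groups, the threshold order on the integers being compatible with addition. The order is an antichain if it is the equality relation; an antichain in $G$ is a set of pairwise incomparable elements. For an order $\leq$ with strict order $<$, $x\leq_{pred}y$ means that for all $z$, $z<x$ implies $z<y$, and $x\leq_{succ}y$ means that for all $z$, $y<z$ implies $x<z$. A threshold order is an order for which $\leq_{pred}$ and $\leq_{succ}$ are total orders and are equal. $K(G)$ denotes the equivalence class of $0$ for the equivalence relation "$x\leq_{pred}y$ and $y\leq_{pred}x$". $I(G)(0)$ denotes the connected component of $0$ in the incomparability graph of $(X,\leq)$ (whose edges are the pairs of incomparable elements). An order is a semiorder if it embeds neither $2\oplus 2$ nor $3\oplus 1$, where $r\oplus s$ is the disjoint union of an $r$-element chain and an $s$-element chain with no comparabilities between them. *)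

theory Defs
  imports Main
begin

locale ordered_group = ordering less_eq less
  for less_eq less :: "'a::group_add \<Rightarrow> 'a \<Rightarrow> bool" +
  assumes add_left_mono: "less_eq x y \<Longrightarrow> less_eq (z + x) (z + y)"
    and add_right_mono: "less_eq x y \<Longrightarrow> less_eq (x + z) (y + z)"

definition order_embedding_on ::
    "'a set \<Rightarrow> ('a \<Rightarrow> 'a \<Rightarrow> bool) \<Rightarrow> 'b set \<Rightarrow> ('b \<Rightarrow> 'b \<Rightarrow> bool) \<Rightarrow> ('a \<Rightarrow> 'b) \<Rightarrow> bool" where
  "order_embedding_on A le\<^sub>1 B le\<^sub>2 f \<longleftrightarrow>
     f ` A \<subseteq> B \<and> inj_on f A \<and> (\<forall>x\<in>A. \<forall>y\<in>A. le\<^sub>1 x y \<longleftrightarrow> le\<^sub>2 (f x) (f y))"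

definition order_isomorphic_on ::
    "'a set \<Rightarrow> ('a \<Rightarrow> 'a \<Rightarrow> bool) \<Rightarrow> 'b set \<Rightarrow> ('b \<Rightarrow> 'b \<Rightarrow> bool) \<Rightarrow> bool" where
  "order_isomorphic_on A le\<^sub>1 B le\<^sub>2 \<longleftrightarrow>
     (\<exists>f. bij_betw f A B \<and> (\<forall>x\<in>A. \<forall>y\<in>A. le\<^sub>1 x y \<longleftrightarrow> le\<^sub>2 (f x) (f y)))"

definition ordered_group_isomorphic ::
    "('a::group_add \<Rightarrow> 'a \<Rightarrow> bool) \<Rightarrow> ('b::group_add \<Rightarrow> 'b \<Rightarrow> bool) \<Rightarrow> bool" where
  "ordered_group_isomorphic le\<^sub>1 le\<^sub>2 \<longleftrightarrow>
     (\<exists>f. bij f \<and> (\<forall>x y. f (x + y) = f x + f y) \<and> (\<forall>x y. le\<^sub>1 x y \<longleftrightarrow> le\<^sub>2 (f x) (f y)))"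

definition incomparable :: "('a \<Rightarrow> 'a \<Rightarrow> bool) \<Rightarrow> 'a \<Rightarrow> 'a \<Rightarrow> bool" where
  "incomparable le x y \<longleftrightarrow> \<not> le x y \<and> \<not> le y x"

definition antichain :: "('a \<Rightarrow> 'a \<Rightarrow> bool) \<Rightarrow> 'a set \<Rightarrow> bool" where
  "antichain le A \<longleftrightarrow> (\<forall>x\<in>A. \<forall>y\<in>A. x \<noteq> y \<longrightarrow> incomparable le x y)"

definition incomparability_component :: "('a \<Rightarrow> 'a \<Rightarrow> bool) \<Rightarrow> 'a \<Rightarrow> 'a set" where
  "incomparability_component le x = {y. (incomparable le)\<^sup>*\<^sup>* x y}"

text \<open>
  The disjoint union of a chain with \<open>r\<close> and a chain with \<open>s\<close> elements is carried by
  \<open>{..<r} <+> {..<s}\<close>; \<open>rel_sum\<close> is false between the two summands.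
\<close>

definition embeds_chain_sum :: "nat \<Rightarrow> nat \<Rightarrow> ('a \<Rightarrow> 'a \<Rightarrow> bool) \<Rightarrow> bool" where
  "embeds_chain_sum r s le \<longleftrightarrow>
     (\<exists>f. order_embedding_on ({..<r} <+> {..<s}) (rel_sum (\<le>) (\<le>)) UNIV le f)"

definition semiorder :: "('a \<Rightarrow> 'a \<Rightarrow> bool) \<Rightarrow> ('a \<Rightarrow> 'a \<Rightarrow> bool) \<Rightarrow> bool" where
  "semiorder le lt \<longleftrightarrow>
     ordering le lt \<and> \<not> embeds_chain_sum 2 2 le \<and> \<not> embeds_chain_sum 3 1 le"

definition le_pred :: "('a \<Rightarrow> 'a \<Rightarrow> bool) \<Rightarrow> 'a \<Rightarrow> 'a \<Rightarrow> bool" where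
  "le_pred lt x y \<longleftrightarrow> (\<forall>z. lt z x \<longrightarrow> lt z y)"

definition le_succ :: "('a \<Rightarrow> 'a \<Rightarrow> bool) \<Rightarrow> 'a \<Rightarrow> 'a \<Rightarrow> bool" where
  "le_succ lt x y \<longleftrightarrow> (\<forall>z. lt y z \<longrightarrow> lt x z)"

definition threshold_order :: "('a \<Rightarrow> 'a \<Rightarrow> bool) \<Rightarrow> ('a \<Rightarrow> 'a \<Rightarrow> bool) \<Rightarrow> bool" where
  "threshold_order le lt \<longleftrightarrow>
     ordering le lt \<and>
     linear_order {(x, y). le_pred lt x y} \<and>
     linear_order {(x, y). le_succ lt x y} \<and>
     le_pred lt = le_succ lt"

definition pred_kernel :: "('a::zero \<Rightarrow> 'a \<Rightarrow> bool) \<Rightarrow> 'a set" where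
  "pred_kernel lt = {x. le_pred lt x 0 \<and> le_pred lt 0 x}"

end

theory Submission
  imports Defs
begin

text \<open>
  The proof compares the given order \<open><\<close> with the preorder \<open>\<preceq>\<close>, which is \<^term>\<open>le_pred\<close>. In an
  ordered group \<open>\<le>\<^sub>p\<^sub>r\<^sub>e\<^sub>d\<close> and \<open>\<le>\<^sub>s\<^sub>u\<^sub>c\<^sub>c\<close> coincide and are invariant under translations, and when
  \<open>2 \<oplus> 2\<close> does not embed, \<open>\<preceq>\<close> is total. From \<open>x \<preceq> c < d \<preceq> y\<close> one gets \<open>x < y\<close>; hence the
  \<open>\<preceq>\<close>-interval between two elements that are not in the relation \<open>x < y\<close> is an antichain
  (\<open>antichain_le_pred_interval\<close>). As the incomparability graph is connected, every
  \<open>\<preceq>\<close>-interval is covered by finitely many such antichains. A set that meets every antichain in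
  a finite set therefore meets every \<open>\<preceq>\<close>-interval in a finite set
  (\<open>finite_Int_le_pred_interval\<close>).

  This applies to two sets. A maximal chain meets every antichain at most once, so it is a
  locally finite chain; it has no end points, because the order is not equality and positive
  elements can be added and subtracted. So it is isomorphic to the integers. If \<open>K(G) = {0}\<close> and
  there is no infinite antichain, then the whole group is a locally finite chain without end
  points for the order \<open>\<preceq>\<close>. Counting elements between \<open>0\<close> and \<open>x\<close> with sign is then an order
  isomorphism from \<open>(G, \<preceq>)\<close> to the integers, and it is additive since translations preserve
  the number of elements of an interval. The order transported along it is a threshold order,
  because \<open>K(G) = {0}\<close> makes the total preorder \<open>\<preceq>\<close> antisymmetric. Conversely, for a threshold
  order antisymmetry of \<open>\<preceq>\<close> gives \<open>K(G) = {0}\<close>; and a translation-invariant order on the integers other than equality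
  has a positive element \<open>p\<close>, so that two integers in the same residue class modulo \<open>p\<close> are
  comparable and antichains are finite.
\<close>

section \<open>Locally finite chains without end points\<close>

locale unbounded_discrete_chain =
  fixes C :: "'a set" and le :: "'a \<Rightarrow> 'a \<Rightarrow> bool"
  assumes reflC: "x \<in> C \<Longrightarrow> le x x"
    and transC: "\<lbrakk>x \<in> C; y \<in> C; z \<in> C; le x y; le y z\<rbrakk> \<Longrightarrow> le x z"
    and antisymC: "\<lbrakk>x \<in> C; y \<in> C; le x y; le y x\<rbrakk> \<Longrightarrow> x = y"
    and totalC: "\<lbrakk>x \<in> C; y \<in> C\<rbrakk> \<Longrightarrow> le x y \<or> le y x"
    and finite_interval: "\<lbrakk>x \<in> C; y \<in> C\<rbrakk> \<Longrightarrow> finite {c \<in> C. le x c \<and> le c y}"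
    and no_greatest: "x \<in> C \<Longrightarrow> \<exists>y\<in>C. le x y \<and> x \<noteq> y"
    and no_least: "x \<in> C \<Longrightarrow> \<exists>y\<in>C. le y x \<and> x \<noteq> y"
begin

definition half_open_interval :: "'a \<Rightarrow> 'a \<Rightarrow> 'a set" where
  "half_open_interval x y = {c \<in> C. le x c \<and> le c y \<and> c \<noteq> y}"

definition signed_distance :: "'a \<Rightarrow> 'a \<Rightarrow> int" where
  "signed_distance x y = int (card (half_open_interval x y)) - int (card (half_open_interval y x))"

lemma finite_half_open_interval: "\<lbrakk>x \<in> C; y \<in> C\<rbrakk> \<Longrightarrow> finite (half_open_interval x y)"
  by (rule finite_subset[OF _ finite_interval[of x y]]) (auto simp: half_open_interval_def)

lemma half_open_interval_empty: "\<lbrakk>x \<in> C; y \<in> C; le y x\<rbrakk> \<Longrightarrow> half_open_interval x y = {}"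
  unfolding half_open_interval_def using transC[of y x] antisymC[of _ y] by blast

lemma signed_distance_swap: "signed_distance y x = - signed_distance x y"
  by (simp add: signed_distance_def)

lemma signed_distance_le: "\<lbrakk>x \<in> C; y \<in> C; le x y\<rbrakk>
    \<Longrightarrow> signed_distance x y = int (card (half_open_interval x y))"
  by (simp add: signed_distance_def half_open_interval_empty)

lemma signed_distance_add_le:
  assumes C: "x \<in> C" "y \<in> C" "z \<in> C" and le: "le x y" "le y z"
  shows "signed_distance x z = signed_distance x y + signed_distance y z"
proof -
  have xz: "le x z" using transC C le by blast
  have "half_open_interval x z = half_open_interval x y \<union> half_open_interval y z"
  proof (intro equalityI subsetI)
    fix c assume c: "c \<in> half_open_interval x z"
    then have "le c y \<or> le y c" using totalC C(2) by (auto simp: half_open_interval_def)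
    then show "c \<in> half_open_interval x y \<union> half_open_interval y z"
      using c C reflC by (cases "c = y") (auto simp: half_open_interval_def)
  next
    fix c assume "c \<in> half_open_interval x y \<union> half_open_interval y z"
    then consider "c \<in> C" "le x c" "le c y" "c \<noteq> y" | "c \<in> C" "le y c" "le c z" "c \<noteq> z"
      by (auto simp: half_open_interval_def)
    then show "c \<in> half_open_interval x z"
    proof cases
      case 1
      then have "le c z" "c \<noteq> z" using transC[of c y z] antisymC[of c y] C le by auto
      then show ?thesis using 1 by (simp add: half_open_interval_def)
    next
      case 2
      then have "le x c" using transC[of x y c] C le by blast
      then show ?thesis using 2 by (simp add: half_open_interval_def)
    qed
  qed
  moreover have "half_open_interval x y \<inter> half_open_interval y z = {}"
    unfolding half_open_interval_def using antisymC[of _ y] C by blast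
  ultimately have "card (half_open_interval x z) =
      card (half_open_interval x y) + card (half_open_interval y z)"
    using card_Un_disjoint finite_half_open_interval C by metis
  then show ?thesis using signed_distance_le C le xz by simp
qed

text \<open>The sign convention makes additivity independent of the order of the three points.\<close>

lemma signed_distance_add:
  assumes C: "x \<in> C" "y \<in> C" "z \<in> C"
  shows "signed_distance x z = signed_distance x y + signed_distance y z"
proof -
  note swap = signed_distance_swap[of x y] signed_distance_swap[of y z] signed_distance_swap[of x z]
  consider "le x y" "le y z" | "le x z" "le z y" | "le y x" "le x z"
    | "le y z" "le z x" | "le z x" "le x y" | "le z y" "le y x"
    using totalC[of x y] totalC[of y z] totalC[of x z] C by blast
  then show ?thesis
  proof cases
    case 1
    then show ?thesis using signed_distance_add_le[of x y z] C by simp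
  next
    case 2
    then show ?thesis using signed_distance_add_le[of x z y] C swap by linarith
  next
    case 3
    then show ?thesis using signed_distance_add_le[of y x z] C swap by linarith
  next
    case 4
    then show ?thesis using signed_distance_add_le[of y z x] C swap by linarith
  next
    case 5
    then show ?thesis using signed_distance_add_le[of z x y] C swap by linarith
  next
    case 6
    then show ?thesis using signed_distance_add_le[of z y x] C swap by linarith
  qed
qed

lemma signed_distance_nonneg_iff:
  assumes C: "x \<in> C" "y \<in> C"
  shows "0 \<le> signed_distance x y \<longleftrightarrow> le x y"
proof (cases "le x y")
  case True
  then show ?thesis using signed_distance_le C by simp
next
  case False
  then have "le y x" "x \<noteq> y" using totalC reflC C by auto
  then have "y \<in> half_open_interval y x" using reflC C by (auto simp: half_open_interval_def)
  then have "card (half_open_interval y x) > 0"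
    using finite_half_open_interval C by (auto simp: card_gt_0_iff)
  then have "signed_distance x y < 0"
    using signed_distance_le[of y x] signed_distance_swap[of x y] C \<open>le y x\<close> by simp
  then show ?thesis using False by simp
qed

lemma signed_distance_le_iff:
  assumes "a \<in> C" "x \<in> C" "y \<in> C"
  shows "signed_distance a x \<le> signed_distance a y \<longleftrightarrow> le x y"
  using signed_distance_add[of a x y] signed_distance_nonneg_iff[of x y] assms by simp

lemma inj_on_signed_distance:
  assumes "a \<in> C"
  shows "inj_on (signed_distance a) C"
  using signed_distance_le_iff[OF assms] antisymC by (metis inj_onI order_refl)

text \<open>
  In each direction the cover of \<open>x\<close> is the element nearest to \<open>x\<close> in a nonempty finite interval;
  it exists because there are no end points.
\<close>

lemma ex_successor:
  assumes x: "x \<in> C"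
  shows "\<exists>y\<in>C. signed_distance x y = 1"
proof -
  obtain z where z: "z \<in> C" "le x z" "x \<noteq> z" using no_greatest x by blast
  define S where "S = {c \<in> C. le x c \<and> le c z} - {x}"
  have "finite S" "S \<noteq> {}" using z x finite_interval reflC by (auto simp: S_def)
  then obtain y where y: "y \<in> S" and min: "\<And>c. c \<in> S \<Longrightarrow> signed_distance x y \<le> signed_distance x c"
    using ex_is_arg_min_if_finite[of S "signed_distance x"] by (auto simp: is_arg_min_linorder)
  have yC: "y \<in> C" "le x y" "y \<noteq> x" "le y z" using y by (auto simp: S_def)
  have "c = x" if c: "c \<in> half_open_interval x y" for c
  proof (rule ccontr)
    assume "c \<noteq> x"
    then have "c \<in> S" using c yC z transC[of c y z] by (auto simp: half_open_interval_def S_def)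
    then have "le y c" using min[of c] signed_distance_le_iff[of x y c] x yC c
      by (simp add: half_open_interval_def)
    then show False using c yC antisymC[of c y] by (auto simp: half_open_interval_def)
  qed
  then have "half_open_interval x y = {x}" using x yC reflC by (auto simp: half_open_interval_def)
  then have "signed_distance x y = 1" using signed_distance_le x yC by simp
  then show ?thesis using yC by blast
qed

lemma ex_predecessor:
  assumes x: "x \<in> C"
  shows "\<exists>y\<in>C. signed_distance x y = - 1"
proof -
  obtain z where z: "z \<in> C" "le z x" "x \<noteq> z" using no_least x by blast
  define S where "S = {c \<in> C. le z c \<and> le c x} - {x}"
  have "finite S" "S \<noteq> {}" using z x finite_interval reflC by (auto simp: S_def)
  then obtain y where y: "y \<in> S" and max: "\<And>c. c \<in> S \<Longrightarrow> signed_distance x c \<le> signed_distance x y"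
    using ex_is_arg_min_if_finite[of S "\<lambda>c. signed_distance c x"] signed_distance_swap[of x]
    by (auto simp: is_arg_min_linorder)
  have yC: "y \<in> C" "le y x" "y \<noteq> x" "le z y" using y by (auto simp: S_def)
  have "c = y" if c: "c \<in> half_open_interval y x" for c
  proof -
    have "c \<in> S" using c yC z transC[of z y c] by (auto simp: half_open_interval_def S_def)
    then have "le c y" using max[of c] signed_distance_le_iff[of x c y] x yC c
      by (simp add: half_open_interval_def)
    then show "c = y" using c yC antisymC[of c y] by (auto simp: half_open_interval_def)
  qed
  then have "half_open_interval y x = {y}" using x yC reflC by (auto simp: half_open_interval_def)
  then have "signed_distance x y = - 1"
    using signed_distance_le[of y x] signed_distance_swap[of x y] x yC by simp
  then show ?thesis using yC by blast
qed

lemma bij_betw_signed_distance: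
  assumes a: "a \<in> C"
  shows "bij_betw (signed_distance a) C UNIV"
proof -
  have "\<exists>x\<in>C. signed_distance a x = k" for k
  proof (induction k rule: int_induct[where k = 0])
    case base
    show ?case using a by (intro bexI[of _ a]) (simp_all add: signed_distance_def)
  next
    case (step1 i)
    then obtain x where "x \<in> C" "signed_distance a x = i" by blast
    then show ?case using ex_successor[of x] signed_distance_add[of a x] a by metis
  next
    case (step2 i)
    then obtain x where "x \<in> C" "signed_distance a x = i" by blast
    then show ?case using ex_predecessor[of x] signed_distance_add[of a x] a
      by (metis uminus_add_conv_diff add.commute)
  qed
  then have "signed_distance a ` C = UNIV" by (metis UNIV_eq_I image_eqI)
  then show ?thesis using inj_on_signed_distance a by (simp add: bij_betw_def)
qed

end

section \<open>The preorder of predecessor sets in an ordered group\<close>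

lemma le_pred_refl: "le_pred lt x x"
  by (simp add: le_pred_def)

lemma le_pred_trans: "\<lbrakk>le_pred lt x y; le_pred lt y z\<rbrakk> \<Longrightarrow> le_pred lt x z"
  by (simp add: le_pred_def)

text \<open>
  If \<open>a < x\<close> witnesses that \<open>x \<preceq> y\<close> fails and \<open>b < y\<close> that \<open>y \<preceq> x\<close> fails, these two
  chains are a copy of \<open>2 \<oplus> 2\<close>.
\<close>

lemma le_pred_total:
  assumes "ordering le lt" and free: "\<not> embeds_chain_sum 2 2 le"
  shows "le_pred lt x y \<or> le_pred lt y x"
proof (rule ccontr)
  interpret ordering le lt by fact
  assume "\<not> ?thesis"
  then obtain a b where ab: "lt a x" "\<not> lt a y" "lt b y" "\<not> lt b x"
    by (auto simp: le_pred_def)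
  define f where "f = case_sum (\<lambda>i::nat. if i = 0 then a else x) (\<lambda>i::nat. if i = 0 then b else y)"
  have nle: "\<not> le a b" "\<not> le b a" "\<not> le a y" "\<not> le y a" "\<not> le x b" "\<not> le b x" "\<not> le x y"
      "\<not> le y x" "\<not> le x a" "\<not> le y b" and le: "le a x" "le b y"
    using ab by (metis strict_trans1 strict_trans2 strict_iff_order antisym trans)+
  have lt2: "{..<2::nat} = {0, 1}" by auto
  have "order_embedding_on ({..<2} <+> {..<2}) (rel_sum (\<le>) (\<le>)) UNIV le f"
    unfolding order_embedding_on_def lt2
    using nle le refl by (auto simp: f_def inj_on_def Plus_def)
  then show False using free by (auto simp: embeds_chain_sum_def)
qed

context ordered_group
begin

lemma strict_left_translate [simp]: "less (z + x) (z + y) \<longleftrightarrow> less x y"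
  using add_left_mono[of x y z] add_left_mono[of "z + x" "z + y" "- z"]
  by (auto simp: strict_iff_order add.assoc[symmetric])

lemma strict_right_translate [simp]: "less (x + z) (y + z) \<longleftrightarrow> less x y"
  using add_right_mono[of x y z] add_right_mono[of "x + z" "y + z" "- z"]
  by (auto simp: strict_iff_order add.assoc)

lemma ex_positive:
  assumes "less_eq \<noteq> (=)"
  shows "\<exists>p. less 0 p"
proof -
  obtain x y where "less x y"
    using assms refl strict_iff_order by blast
  then have "less (- x + x) (- x + y)" by (simp only: strict_left_translate)
  then show ?thesis by auto
qed

text \<open>
  A translate moves the test element \<open>z\<close> from one side to the other: \<open>y < z\<close> holds exactly
  if \<open>x - z + y < x\<close>, and \<open>x < z\<close> exactly if \<open>x - z + y < y\<close>. Commutativity is replaced by the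
  use of both left and right translations.
\<close>

lemma le_pred_eq_le_succ: "le_pred less = le_succ less"
proof (intro ext iffI)
  fix x y
  have shift: "less (x - z + y) x \<longleftrightarrow> less y z" "less (x - z + y) y \<longleftrightarrow> less x z"
      "less y (x - z + y) \<longleftrightarrow> less z x" "less x (x - z + y) \<longleftrightarrow> less z y" for z
    using strict_left_translate[of "x - z" y z] strict_right_translate[of "x - z" y 0]
      strict_right_translate[of "x - z" z 0] strict_right_translate[of 0 y "x - z"]
      strict_right_translate[of 0 z "x - z"] strict_left_translate[of "x - z" z y]
    by simp_all
  show "le_succ less x y" if "le_pred less x y"
    using that shift unfolding le_pred_def le_succ_def by blast
  show "le_pred less x y" if "le_succ less x y"
    using that shift unfolding le_pred_def le_succ_def by blast
qed

lemma le_pred_left_translate [simp]: "le_pred less (a + x) (a + y) \<longleftrightarrow> le_pred less x y"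
proof -
  have *: "le_pred less (b + u) (b + v)" if "le_pred less u v" for b u v
    unfolding le_pred_def
  proof (intro allI impI)
    fix z assume "less z (b + u)"
    then have "less (- b + z) u"
      using strict_left_translate[of b "- b + z" u] by (simp add: add.assoc[symmetric])
    then have "less (- b + z) v" using that by (simp add: le_pred_def)
    then show "less z (b + v)"
      using strict_left_translate[of b "- b + z" v] by (simp add: add.assoc[symmetric])
  qed
  from *[of x y a] *[of "a + x" "a + y" "- a"] show ?thesis
    by (auto simp: add.assoc[symmetric])
qed

lemma le_pred_right_translate [simp]: "le_pred less (x + a) (y + a) \<longleftrightarrow> le_pred less x y"
proof -
  have *: "le_pred less (u + b) (v + b)" if "le_pred less u v" for b u v
    unfolding le_pred_def
  proof (intro allI impI)
    fix z assume "less z (u + b)"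
    then have "less (z - b) u" using strict_right_translate[of "z - b" b u] by simp
    then have "less (z - b) v" using that by (simp add: le_pred_def)
    then show "less z (v + b)" using strict_right_translate[of "z - b" b v] by simp
  qed
  from *[of x y a] *[of "x + a" "y + a" "- a"] show ?thesis
    by (auto simp: add.assoc)
qed

lemma strict_imp_le_pred: "less x y \<Longrightarrow> le_pred less x y"
  by (metis le_pred_def strict_trans)

lemma strict_imp_not_le_pred: "less x y \<Longrightarrow> \<not> le_pred less y x"
  by (metis le_pred_def irrefl)

lemma le_pred_antisym:
  assumes K: "pred_kernel less = {0}" and "le_pred less x y" "le_pred less y x"
  shows "x = y"
proof -
  have "le_pred less (x - y) 0" "le_pred less 0 (x - y)"
    using assms le_pred_right_translate[of x "- y" y] le_pred_right_translate[of y "- y" x]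
    by simp_all
  then have "x - y \<in> {0}" unfolding K[symmetric] by (simp add: pred_kernel_def)
  then show ?thesis by simp
qed

section \<open>Intervals, antichains and connectedness\<close>

text \<open>
  Since \<open>\<preceq>\<close> is both the predecessor and the successor preorder, a strict step \<open>c < d\<close> inside the
  interval propagates to both ends: \<open>c < y\<close> because \<open>d \<preceq> y\<close>, and then \<open>x < y\<close> because
  \<open>x \<preceq> c\<close>.
\<close>

lemma antichain_le_pred_interval:
  assumes "\<not> less x y"
  shows "antichain less_eq {z. le_pred less x z \<and> le_pred less z y}"
proof -
  have "\<not> less c d" if "le_pred less x c" "le_pred less d y" for c d
  proof
    assume "less c d"
    then have "less c y" using that by (simp add: le_pred_def)
    moreover have "le_succ less x c" using that le_pred_eq_le_succ by simp
    ultimately show False using assms by (simp add: le_succ_def)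
  qed
  then show ?thesis by (auto simp: antichain_def incomparable_def order_iff_strict)
qed

text \<open>
  Induction along a path in the incomparability graph: the interval from \<open>x\<close> to the end of the
  path grows at each edge by at most an antichain.
\<close>

lemma finite_Int_le_pred_interval:
  assumes total: "\<And>x y. le_pred less x y \<or> le_pred less y x"
    and connected: "incomparability_component less_eq 0 = UNIV"
    and small: "\<And>A. antichain less_eq A \<Longrightarrow> finite (C \<inter> A)"
  shows "finite (C \<inter> {z. le_pred less x z \<and> le_pred less z y})"
proof -
  have sym: "symp (incomparable less_eq)" by (auto simp: symp_def incomparable_def)
  have "(incomparable less_eq)\<^sup>*\<^sup>* 0 x" "(incomparable less_eq)\<^sup>*\<^sup>* 0 y"
    using connected by (auto simp: incomparability_component_def)
  then have "(incomparable less_eq)\<^sup>*\<^sup>* x y"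
    using sympD[OF symp_rtranclp[OF sym]] rtranclp_trans by metis
  then show ?thesis
  proof induction
    case base
    show ?case using small antichain_le_pred_interval irrefl by blast
  next
    case (step y z)
    have "\<not> less y z" using step(2) by (simp add: incomparable_def order_iff_strict)
    then have "finite (C \<inter> {w. le_pred less y w \<and> le_pred less w z})"
      using small antichain_le_pred_interval by blast
    with step.IH show ?case
      by (rule finite_subset[rotated, OF finite_UnI]) (use total in blast)
  qed
qed

section \<open>Maximal chains\<close>

lemma maxchain_unbounded_discrete:
  assumes total: "\<And>x y. le_pred less x y \<or> le_pred less y x"
    and connected: "incomparability_component less_eq 0 = UNIV"
    and nontrivial: "less_eq \<noteq> (=)"
    and max: "pred_on.maxchain UNIV less C"
  shows "unbounded_discrete_chain C less_eq"
proof -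
  have chain: "x = y \<or> less x y \<or> less y x" if "x \<in> C" "y \<in> C" for x y
    using max that by (auto simp: pred_on.maxchain_def pred_on.chain_def)
  have in_C: "u \<in> C" if "\<And>c. c \<in> C \<Longrightarrow> c = u \<or> less c u \<or> less u c" for u
  proof (rule ccontr)
    assume "u \<notin> C"
    moreover have "pred_on.chain UNIV less (insert u C)"
      using chain that by (auto simp: pred_on.chain_def)
    ultimately show False using max by (auto simp: pred_on.maxchain_def)
  qed
  obtain p where p: "less 0 p" using ex_positive nontrivial by blast
  have up: "less x (x + p)" and down: "less (x - p) x" for x
    using strict_left_translate[of x 0 p] strict_left_translate[of "x - p" 0 p] p by simp_all
  have "finite (C \<inter> A)" if "antichain less_eq A" for A
  proof (cases "C \<inter> A = {}")
    case False
    then obtain a where "a \<in> C \<inter> A" by blast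
    then have "C \<inter> A \<subseteq> {a}"
      using chain that by (auto simp: antichain_def incomparable_def order_iff_strict)
    then show ?thesis using finite_subset by blast
  qed simp
  note fin = finite_Int_le_pred_interval[OF total connected this]
  show ?thesis
  proof
    show "finite {c \<in> C. less_eq x c \<and> less_eq c y}" for x y
      by (rule finite_subset[OF _ fin[of x y]])
        (auto simp: order_iff_strict le_pred_refl strict_imp_le_pred)
    show "\<exists>y\<in>C. less_eq x y \<and> x \<noteq> y" if x: "x \<in> C" for x
    proof (rule ccontr)
      assume *: "\<not> ?thesis"
      then have "less_eq c x" if "c \<in> C" for c using chain[OF that x] that by (auto simp: order_iff_strict)
      then have "less c (x + p)" if "c \<in> C" for c using that up strict_trans1 by blast
      then have "x + p \<in> C" using in_C by blast
      then show False using * up[of x] by (auto simp: strict_iff_order)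
    qed
    show "\<exists>y\<in>C. less_eq y x \<and> x \<noteq> y" if x: "x \<in> C" for x
    proof (rule ccontr)
      assume *: "\<not> ?thesis"
      then have "less_eq x c" if "c \<in> C" for c using chain[OF that x] that by (auto simp: order_iff_strict)
      then have "less (x - p) c" if "c \<in> C" for c using that down strict_trans2 by blast
      then have "x - p \<in> C" using in_C by blast
      then show False using * down[of x] by (metis strict_iff_order)
    qed
    show "less_eq x y \<or> less_eq y x" if "x \<in> C" "y \<in> C" for x y
      using chain[OF that] by (auto simp: order_iff_strict)
  qed (use refl trans antisym in blast)+
qed

lemma maxchain_isomorphic_int:
  assumes "\<And>x y. le_pred less x y \<or> le_pred less y x"
    and "incomparability_component less_eq 0 = UNIV"
    and "less_eq \<noteq> (=)"
    and max: "pred_on.maxchain UNIV less C"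
  shows "order_isomorphic_on C less_eq (UNIV :: int set) (\<le>)"
proof -
  interpret chain: unbounded_discrete_chain C less_eq
    using maxchain_unbounded_discrete assms by blast
  \<comment> \<open>A maximal chain is nonempty, since the empty chain extends to a singleton.\<close>
  have "pred_on.chain UNIV less {0}" by (simp add: pred_on.chain_def)
  then have "C \<noteq> {}" using max unfolding pred_on.maxchain_def by blast
  then obtain a where "a \<in> C" by blast
  then show ?thesis
    using chain.bij_betw_signed_distance chain.signed_distance_le_iff
    unfolding order_isomorphic_on_def by blast
qed

section \<open>Isomorphism with the group of integers\<close>

text \<open>
  The map counts, with sign, the elements between \<open>0\<close> and its argument. It is additive: with \<open>d\<close> for
  the signed distance, \<open>d(0, x + y) = d(0, x) + d(x, x + y)\<close>, and the last summand is \<open>d(0, y)\<close> because left translation by \<open>x\<close> maps intervals onto intervals.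
\<close>

lemma ex_additive_bij_int:
  assumes total: "\<And>x y. le_pred less x y \<or> le_pred less y x"
    and connected: "incomparability_component less_eq 0 = UNIV"
    and nontrivial: "less_eq \<noteq> (=)"
    and kernel: "pred_kernel less = {0}"
    and small: "\<nexists>A. antichain less_eq A \<and> infinite A"
  shows "\<exists>f :: 'a \<Rightarrow> int. bij f \<and> (\<forall>x y. f (x + y) = f x + f y)"
proof -
  obtain p where p: "less 0 p" using ex_positive nontrivial by blast
  have up: "less x (x + p)" and down: "less (x - p) x" for x
    using strict_left_translate[of x 0 p] strict_left_translate[of "x - p" 0 p] p by simp_all
  interpret chain: unbounded_discrete_chain UNIV "le_pred less"
  proof
    show "finite {c \<in> UNIV. le_pred less x c \<and> le_pred less c y}" for x y
      using finite_Int_le_pred_interval[OF total connected, of UNIV x y] small by auto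
    show "\<exists>y\<in>UNIV. le_pred less x y \<and> x \<noteq> y" for x
      using up[of x] strict_imp_le_pred irrefl by (metis UNIV_I)
    show "\<exists>y\<in>UNIV. le_pred less y x \<and> x \<noteq> y" for x
      using down[of x] strict_imp_le_pred irrefl by (metis UNIV_I)
  qed (use total in \<open>blast intro: le_pred_refl le_pred_trans le_pred_antisym[OF kernel]\<close>)+
  define f where "f = chain.signed_distance 0"
  have "chain.half_open_interval (z + x) (z + y) = (+) z ` chain.half_open_interval x y" for x y z
  proof (intro equalityI subsetI)
    fix c assume c: "c \<in> chain.half_open_interval (z + x) (z + y)"
    have "c = z + (- z + c)" by (simp add: add.assoc[symmetric])
    then obtain d where d: "c = z + d" by blast
    then have "d \<in> chain.half_open_interval x y" using c by (simp add: chain.half_open_interval_def)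
    then show "c \<in> (+) z ` chain.half_open_interval x y" using d by blast
  qed (auto simp: chain.half_open_interval_def)
  then have "chain.signed_distance (z + x) (z + y) = chain.signed_distance x y" for x y z
    by (simp add: chain.signed_distance_def card_image)
  from this[of _ 0] have "f (x + y) = f x + f y" for x y
    using chain.signed_distance_add[of 0 x "x + y"] by (simp add: f_def)
  moreover have "bij f" using chain.bij_betw_signed_distance by (simp add: f_def)
  ultimately show ?thesis by blast
qed

end

lemma threshold_orderI:
  assumes "ordered_group le lt"
    and total: "\<And>x y. le_pred lt x y \<or> le_pred lt y x"
    and kernel: "pred_kernel lt = {0}"
  shows "threshold_order le lt"
proof -
  interpret ordered_group le lt by fact
  have "linear_order {(x, y). le_pred lt x y}"
    unfolding linear_order_on_def partial_order_on_def preorder_on_def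
    using le_pred_refl le_pred_trans le_pred_antisym[OF kernel] total
    by (fastforce simp: refl_on_def trans_def antisym_def total_on_def)
  then show ?thesis
    using ordering_axioms by (simp add: threshold_order_def le_pred_eq_le_succ)
qed

lemma additive_zero:
  fixes f :: "'a::group_add \<Rightarrow> 'b::group_add"
  assumes "\<And>x y. f (x + y) = f x + f y"
  shows "f 0 = 0"
  using assms[of 0 0] add_left_cancel[of "f 0" "f 0" 0] by simp

lemma ordered_group_transport:
  fixes f :: "'a::group_add \<Rightarrow> 'b::group_add"
  assumes "ordered_group le lt" and "bij f" and add: "\<And>x y. f (x + y) = f x + f y"
  defines "le' \<equiv> \<lambda>a b. le (inv f a) (inv f b)" and "lt' \<equiv> \<lambda>a b. lt (inv f a) (inv f b)"
  shows "ordered_group le' lt'"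
proof -
  interpret ordered_group le lt by fact
  have f_inv: "f (inv f a) = a" and inv_f: "inv f (f x) = x" for a x
    using \<open>bij f\<close> by (simp_all add: bij_def surj_f_inv_f)
  have inv_add: "inv f (a + b) = inv f a + inv f b" for a b
    by (metis add f_inv inv_f)
  show ?thesis
    unfolding le'_def lt'_def
  proof
    fix a b c
    show "lt (inv f a) (inv f b) = (le (inv f a) (inv f b) \<and> a \<noteq> b)"
      using strict_iff_order f_inv by metis
    show "a = b" if "le (inv f a) (inv f b)" "le (inv f b) (inv f a)"
      using antisym[OF that] f_inv by metis
  qed (use refl trans add_left_mono add_right_mono in \<open>auto simp: inv_add\<close>)
qed

lemma le_pred_transport:
  assumes "bij f" and "\<And>x y. lt x y \<longleftrightarrow> lt' (f x) (f y)"
  shows "le_pred lt x y \<longleftrightarrow> le_pred lt' (f x) (f y)"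
  unfolding le_pred_def using assms by (metis bij_pointE)

lemma isomorphic_threshold_int:
  fixes le lt :: "'a::group_add \<Rightarrow> 'a \<Rightarrow> bool" and f :: "'a \<Rightarrow> int"
  assumes "ordered_group le lt" and total: "\<And>x y. le_pred lt x y \<or> le_pred lt y x"
    and kernel: "pred_kernel lt = {0}"
    and f: "bij f" "\<And>x y. f (x + y) = f x + f y"
  shows "\<exists>le' lt' :: int \<Rightarrow> int \<Rightarrow> bool.
           ordered_group le' lt' \<and> threshold_order le' lt' \<and> ordered_group_isomorphic le le'"
proof -
  interpret ordered_group le lt by fact
  define le' lt' where "le' = (\<lambda>a b. le (inv f a) (inv f b))" and "lt' = (\<lambda>a b. lt (inv f a) (inv f b))"
  have f_inv: "f (inv f a) = a" and inv_f: "inv f (f x) = x" for a x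
    using f(1) by (simp_all add: bij_def surj_f_inv_f)
  have og: "ordered_group le' lt'"
    unfolding le'_def lt'_def using ordered_group_transport assms by blast
  have pred: "le_pred lt' a b \<longleftrightarrow> le_pred lt (inv f a) (inv f b)" for a b
    by (rule le_pred_transport) (use f(1) in \<open>simp_all add: bij_imp_bij_inv lt'_def\<close>)
  have inv0: "inv f 0 = 0" using additive_zero f(2) inv_f by metis
  have "pred_kernel lt' = {0}"
  proof -
    have "a \<in> pred_kernel lt' \<longleftrightarrow> inv f a \<in> pred_kernel lt" for a
      by (simp add: pred_kernel_def pred inv0)
    then show ?thesis using kernel inv0 f_inv by (metis equalityI insertI1 singletonD subsetI)
  qed
  then have "threshold_order le' lt'"
    using threshold_orderI[OF og] total pred by blast
  moreover have "ordered_group_isomorphic le le'"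
    unfolding ordered_group_isomorphic_def using f by (auto simp: le'_def inv_f intro!: exI[of _ f])
  ultimately show ?thesis using og by blast
qed

section \<open>Ordered groups on the integers\<close>

text \<open>
  All multiples of a positive \<open>p\<close> form a chain, so reduction modulo \<open>p\<close> is injective on an
  antichain. The positive element of the order may be a negative integer.
\<close>

lemma finite_antichain_int:
  fixes le lt :: "int \<Rightarrow> int \<Rightarrow> bool"
  assumes "ordered_group le lt" and nontrivial: "le \<noteq> (=)" and A: "antichain le A"
  shows "finite A"
proof -
  interpret ordered_group le lt by fact
  obtain p where p: "lt 0 p" using ex_positive nontrivial by blast
  then have "p \<noteq> 0" using irrefl by blast
  have multiple: "le x (x + int n * p)" for x n
  proof (induction n)
    case (Suc n)
    have "le (x + int n * p) (x + int n * p + p)"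
      using add_left_mono[of 0 p "x + int n * p"] p by (simp add: strict_iff_order)
    then show ?case using trans[OF Suc.IH] by (simp add: algebra_simps)
  qed (simp add: refl)
  have "inj_on (\<lambda>x. x mod p) A"
  proof (rule inj_onI, rule ccontr)
    fix x y assume xy: "x \<in> A" "y \<in> A" "x mod p = y mod p" "x \<noteq> y"
    then obtain k where k: "y = x + k * p"
      by (metis mod_eq_dvd_iff dvd_def diff_eq_eq add.commute mult.commute)
    have "le x y \<or> le y x"
    proof (cases "k \<ge> 0")
      case True
      then show ?thesis using multiple[of x "nat k"] k by simp
    next
      case False
      then show ?thesis using multiple[of y "nat (- k)"] k by simp
    qed
    then show False using A xy by (auto simp: antichain_def incomparable_def)
  qed
  moreover have "(\<lambda>x. x mod p) ` A \<subseteq> {- \<bar>p\<bar> .. \<bar>p\<bar>}"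
  proof (intro image_subsetI)
    fix x
    show "x mod p \<in> {- \<bar>p\<bar> .. \<bar>p\<bar>}"
      using abs_mod_less[OF \<open>p \<noteq> 0\<close>, of x] by auto
  qed
  ultimately show ?thesis using finite_subset inj_on_finite finite_atLeastAtMost_int by metis
qed

lemma kernel_trivial_and_antichains_finite:
  fixes le lt :: "'a::group_add \<Rightarrow> 'a \<Rightarrow> bool" and le' lt' :: "int \<Rightarrow> int \<Rightarrow> bool"
  assumes "ordering le lt" and nontrivial: "le \<noteq> (=)"
    and "ordered_group le' lt'" and threshold: "threshold_order le' lt'"
    and "ordered_group_isomorphic le le'"
  shows "pred_kernel lt = {0} \<and> (\<nexists>A. antichain le A \<and> infinite A)"
proof -
  interpret ordering le lt by fact
  interpret int: ordered_group le' lt' by fact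
  obtain f where f: "bij f" "\<And>x y. f (x + y) = f x + f y" "\<And>x y. le x y \<longleftrightarrow> le' (f x) (f y)"
    using assms(5) by (auto simp: ordered_group_isomorphic_def)
  have inj: "f x = f y \<longleftrightarrow> x = y" for x y using f(1) by (simp add: bij_def inj_eq)
  have lt: "lt x y \<longleftrightarrow> lt' (f x) (f y)" for x y
    using f(3) inj by (simp add: strict_iff_order int.strict_iff_order)
  have pred: "le_pred lt x y \<longleftrightarrow> le_pred lt' (f x) (f y)" for x y
    by (rule le_pred_transport) (use f(1) lt in auto)
  have "antisym {(x, y). le_pred lt' x y}"
    using threshold by (simp add: threshold_order_def linear_order_on_def partial_order_on_def)
  then have "x = 0" if "x \<in> pred_kernel lt" for x
    using that inj by (auto simp: pred_kernel_def pred antisym_def)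
  then have "pred_kernel lt = {0}" by (auto simp: pred_kernel_def le_pred_refl)
  moreover have "le' \<noteq> (=)"
  proof
    assume "le' = (=)"
    then have "le = (=)" using f(3) inj by (intro ext) simp
    then show False using nontrivial by contradiction
  qed
  then have "finite A" if "antichain le A" for A
  proof -
    have "antichain le' (f ` A)"
      using that f(3) by (auto simp: antichain_def incomparable_def)
    then have "finite (f ` A)" using finite_antichain_int int.ordered_group_axioms \<open>le' \<noteq> (=)\<close> by blast
    then show ?thesis using inj by (metis finite_imageD inj_onI)
  qed
  ultimately show ?thesis by blast
qed

theorem theorem18:
  fixes le lt :: "'a::group_add \<Rightarrow> 'a \<Rightarrow> bool"
  assumes "ordered_group le lt"
    and "semiorder le lt"
    and "le \<noteq> (=)"
    and "incomparability_component le 0 = UNIV"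
  shows "(\<forall>C. pred_on.maxchain UNIV lt C \<longrightarrow>
            order_isomorphic_on C le (UNIV :: int set) (\<le>)) \<and>
         (pred_kernel lt = {0} \<and> (\<nexists>A. antichain le A \<and> infinite A) \<longleftrightarrow>
          (\<exists>le' lt' :: int \<Rightarrow> int \<Rightarrow> bool.
             ordered_group le' lt' \<and> threshold_order le' lt' \<and>
             ordered_group_isomorphic le le'))"
proof -
  interpret ordered_group le lt by fact
  have total: "le_pred lt x y \<or> le_pred lt y x" for x y
    using le_pred_total[of le lt x y] assms(2) by (simp add: semiorder_def)
  show ?thesis
  proof (intro conjI allI impI iffI)
    show "order_isomorphic_on C le (UNIV :: int set) (\<le>)" if "pred_on.maxchain UNIV lt C" for C
      using maxchain_isomorphic_int[OF total assms(4,3) that] .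
    show "\<exists>le' lt' :: int \<Rightarrow> int \<Rightarrow> bool.
             ordered_group le' lt' \<and> threshold_order le' lt' \<and> ordered_group_isomorphic le le'"
      if "pred_kernel lt = {0} \<and> (\<nexists>A. antichain le A \<and> infinite A)"
      using ex_additive_bij_int[OF total assms(4,3)] isomorphic_threshold_int[OF assms(1) total] that
      by metis
  qed (use kernel_trivial_and_antichains_finite[OF ordering_axioms assms(3)] in blast)+
qed

end
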